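(* Let $\mathcal{X}$ be a finite set with $|\mathcal{X}|\ge2$. Let $\mathcal{Q}=\mathcal{Q}(\mathcal{X},\mathcal{X}^2)$ be the set of positive edge measures on $\mathcal{X}^2$ and $\mathcal{Q}_{\mathsf{rev}}=\mathcal{Q}_{\mathsf{rev}}(\mathcal{X},\mathcal{X}^2)$ the subset of those pertaining to reversible kernels. Then $\mathcal{Q}_{\mathsf{rev}}$ forms both an e-family and an m-family of $\mathcal{P}(\mathcal{X}^2)$, with dimension $|\mathcal{X}|(|\mathcal{X}|+1)/2-1$. Moreover, $\mathcal{Q}$ does not form an e-family in $\mathcal{P}(\mathcal{X}^2)$, except when $|\mathcal{X}|=2$.
   Context: $\mathcal{P}(\mathcal{X}^2)$ here is the set of entrywise positive probability distributions on $\mathcal{X}^2$. $\mathcal{Q}$ is the set of $Q\in\mathcal{P}(\mathcal{X}^2)$ with $\sum_{x'}Q(x,x')=\sum_{x'}Q(x',x)$ for all $x$; equivalently $Q(x,x')=\pi(x)P(x,x')$ with $P$ an entrywise positive row-stochastic matrix and $\pi$ its stationary distribution. $\mathcal{Q}_{\mathsf{rev}}$ is the set of symmetric $Q\in\mathcal{P}(\mathcal{X}^2)$ ($Q(x,x')=Q(x',x)$); equivalently, edge measures of positive kernels $P$ with $\pi(x)P(x,x')=\pi(x')P(x',x)$. For a finite set $\mathcal{Z}$ (here $\mathcal{Z}=\mathcal{X}^2$), a set of positive distributions on $\mathcal{Z}$ is an e-family of dimension $d$ if it equals $\{p_\theta:\theta\in\mathbb{R}^d\}$ with $\log p_\theta(z)=C(z)+\sum_{i=1}^d\theta^iF_i(z)-\psi(\theta)$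 for some $C,F_1,\dots,F_d:\mathcal{Z}\to\mathbb{R}$ with $1,F_1,\dots,F_d$ linearly independent, $\psi$ being the normalizing function (equivalently, it is autoparallel with respect to the e-connection). It is an m-family of dimension $d$ if it equals $\{C+\sum_{i=1}^d\xi^iF_i:\xi\in\mathbb{R}^d\}\cap\{p>0\}$, assumed nonempty, for some $C,F_i:\mathcal{Z}\to\mathbb{R}$ with $\sum_zC(z)=1$, $\sum_zF_i(z)=0$ and $F_1,\dots,F_d$ linearly independent. *)

theory Defs
  imports "HOL-Analysis.Analysis"
begin

text \<open>Real functions on a finite type \<open>'z\<close> are vectors in \<open>real ^ 'z\<close>.\<close>

definition pos_dists :: "(real ^ 'z) set" where
  "pos_dists = {p. (\<forall>z. p $ z > 0) \<and> (\<Sum>z\<in>UNIV. p $ z) = 1}"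

text \<open>Linear independence of the family \<open>F 0, \<dots>, F (n - 1)\<close>; the library predicate
  \<open>independent\<close> is about sets, so repetitions have to be excluded separately.\<close>

definition independent_family :: "nat \<Rightarrow> (nat \<Rightarrow> real ^ 'z) \<Rightarrow> bool" where
  "independent_family n F \<longleftrightarrow> inj_on F {..<n} \<and> independent (F ` {..<n})"

text \<open>A parameter in \<open>\<real>\<^sup>d\<close> is represented by a function on \<open>nat\<close> of which only the values at
  \<open>i < d\<close> matter, and the coordinates are numbered from \<open>0\<close>.\<close>

definition log_partition ::
  "real ^ 'z \<Rightarrow> (nat \<Rightarrow> real ^ 'z) \<Rightarrow> nat \<Rightarrow> (nat \<Rightarrow> real) \<Rightarrow> real" where
  "log_partition C F d \<theta> = ln (\<Sum>z\<in>UNIV. exp (C $ z + (\<Sum>i<d. \<theta> i * F i $ z)))"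

definition exp_member ::
  "real ^ 'z \<Rightarrow> (nat \<Rightarrow> real ^ 'z) \<Rightarrow> nat \<Rightarrow> (nat \<Rightarrow> real) \<Rightarrow> real ^ 'z" where
  "exp_member C F d \<theta> =
    (\<chi> z. exp (C $ z + (\<Sum>i<d. \<theta> i * F i $ z) - log_partition C F d \<theta>))"

text \<open>The independent family is \<open>1, F 0, \<dots>, F (d - 1)\<close>, with \<open>vec 1\<close> the constant function.\<close>

definition e_family :: "nat \<Rightarrow> (real ^ 'z) set \<Rightarrow> bool" where
  "e_family d E \<longleftrightarrow>
    (\<exists>C F. independent_family (Suc d) (case_nat (vec 1) F) \<and> E = range (exp_member C F d))"

definition m_family :: "nat \<Rightarrow> (real ^ 'z) set \<Rightarrow> bool" where
  "m_family d M \<longleftrightarrow>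
    (\<exists>C F. (\<Sum>z\<in>UNIV. C $ z) = 1 \<and> (\<forall>i<d. (\<Sum>z\<in>UNIV. F i $ z) = 0) \<and>
      independent_family d F \<and>
      M = range (\<lambda>\<xi>. C + (\<Sum>i<d. \<xi> i *\<^sub>R F i)) \<inter> {p. \<forall>z. p $ z > 0} \<and> M \<noteq> {})"

definition edge_measures :: "(real ^ ('x::finite \<times> 'x)) set" where
  "edge_measures =
    {Q \<in> pos_dists. \<forall>x. (\<Sum>x'\<in>UNIV. Q $ (x, x')) = (\<Sum>x'\<in>UNIV. Q $ (x', x))}"

text \<open>The edge measure \<open>\<pi>(x) P(x, x')\<close> of a kernel \<open>P\<close> with stationary distribution \<open>\<pi>\<close> is
  symmetric exactly when \<open>P\<close> satisfies detailed balance.\<close>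

definition rev_edge_measures :: "(real ^ ('x::finite \<times> 'x)) set" where
  "rev_edge_measures = {Q \<in> pos_dists. \<forall>x x'. Q $ (x, x') = Q $ (x', x)}"

end

(* Symmetry of Q(x,x') means that Q, or equally log Q, depends only on the unordered pair {x,x'}.
   The functions on X^2 with this property form a linear space S that contains the constants and
   has dimension |X| + (|X| choose 2). Normalization removes the constants: the distributions p
   with p in S form an m-family, those with log p in S an e-family, each of dimension dim S - 1.

   For |X| = 2 every edge measure is symmetric. For |X| >= 3 one uses that an e-family is closed
   under normalized geometric interpolation and extrapolation; since the uniform distribution is
   an edge measure, the normalized square of an edge measure would be an edge measure. Adding to
   the uniform weights one unit along each of the cycles a -> b -> a and a -> b -> c -> a gives
   a counterexample: the cycles overlap in the edge (a, b), so the squared weights increase by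
   8 out of a, but only by 3 + 3 into a. *)

theory Submission
  imports Defs
begin

section \<open>Families spanned by a linear space\<close>

lemma independent_family_exists:
  fixes B :: "(real ^ 'z) set"
  assumes "independent B" "card B = n"
  obtains F where "independent_family n F" "F ` {..<n} = B"
proof -
  have "finite B"
    using assms(1) by (rule finiteI_independent)
  then obtain F where "bij_betw F {..<n} B"
    using ex_bij_betw_nat_finite[of B] assms(2) by (auto simp: atLeast0LessThan)
  then show ?thesis
    using that assms(1) by (auto simp: independent_family_def bij_betw_def)
qed

text \<open>Injectivity of \<open>F\<close> lets coefficients attached to vectors, as in
  \<open>span_finite\<close>, be exchanged for coefficients attached to indices, the form used in
  both kinds of family.\<close>

lemma span_independent_family:
  assumes "independent_family n F"
  shows "span (F ` {..<n}) = range (\<lambda>\<xi>. \<Sum>i<n. \<xi> i *\<^sub>R F i)"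
proof -
  have inj: "inj_on F {..<n}"
    using assms by (simp add: independent_family_def)
  have "range (\<lambda>u. \<Sum>v\<in>F ` {..<n}. u v *\<^sub>R v) = range (\<lambda>\<xi>. \<Sum>i<n. \<xi> i *\<^sub>R F i)"
  proof (intro equalityI subsetI)
    fix w assume "w \<in> range (\<lambda>u. \<Sum>v\<in>F ` {..<n}. u v *\<^sub>R v)"
    then obtain u where "w = (\<Sum>v\<in>F ` {..<n}. u v *\<^sub>R v)"
      by blast
    then have "w = (\<Sum>i<n. (u \<circ> F) i *\<^sub>R F i)"
      using inj by (simp add: sum.reindex)
    then show "w \<in> range (\<lambda>\<xi>. \<Sum>i<n. \<xi> i *\<^sub>R F i)"
      by blast
  next
    fix w assume "w \<in> range (\<lambda>\<xi>. \<Sum>i<n. \<xi> i *\<^sub>R F i)"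
    then obtain \<xi> where "w = (\<Sum>i<n. \<xi> i *\<^sub>R F i)"
      by blast
    then have "w = (\<Sum>v\<in>F ` {..<n}. (\<xi> \<circ> the_inv_into {..<n} F) v *\<^sub>R v)"
      using inj by (simp add: sum.reindex the_inv_into_f_f)
    then show "w \<in> range (\<lambda>u. \<Sum>v\<in>F ` {..<n}. u v *\<^sub>R v)"
      by blast
  qed
  then show ?thesis
    by (simp add: span_finite)
qed

lemma exp_log_partition:
  "exp (log_partition C F d \<theta>) = (\<Sum>z\<in>UNIV. exp (C $ z + (\<Sum>i<d. \<theta> i * F i $ z)))"
  unfolding log_partition_def by (intro exp_ln sum_pos) auto

lemma exp_member_in_pos_dists: "exp_member C F d \<theta> \<in> pos_dists"
proof -
  have "(\<Sum>z\<in>UNIV. exp_member C F d \<theta> $ z)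
      = (\<Sum>z\<in>UNIV. exp (C $ z + (\<Sum>i<d. \<theta> i * F i $ z))) / exp (log_partition C F d \<theta>)"
    by (simp add: exp_member_def exp_diff sum_divide_distrib)
  also have "\<dots> = 1"
    by (simp flip: exp_log_partition)
  finally show ?thesis
    by (simp add: pos_dists_def exp_member_def)
qed

lemma ln_exp_member:
  "ln (exp_member C F d \<theta> $ z) = C $ z + (\<Sum>i<d. \<theta> i * F i $ z) - log_partition C F d \<theta>"
  by (simp add: exp_member_def)

text \<open>Extend \<open>vec 1\<close> to a basis of \<open>S\<close>. The other \<open>d\<close>
  basis vectors become \<open>F\<close>, with \<open>C = 0\<close>, and the coefficient of
  \<open>vec 1\<close> in log p is what the normalizing function supplies.\<close>

lemma e_family_log_subspace:
  fixes S :: "(real ^ 'z) set"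
  assumes "subspace S" "vec 1 \<in> S" "dim S = Suc d"
  shows "e_family d {p \<in> pos_dists. (\<chi> z. ln (p $ z)) \<in> S}"
proof -
  have "independent {vec 1 :: real ^ 'z}"
    by (simp add: vec_eq_iff)
  then obtain B where B: "{vec 1} \<subseteq> B" "B \<subseteq> S" "independent B" "S \<subseteq> span B"
    using maximal_independent_subset_extend[of "{vec 1}" S] assms(2) by auto
  have span_B: "span B = S"
    using B assms(1) by (simp add: span_minimal subset_antisym)
  have "card B = Suc d"
    using B assms(3) by (metis basis_card_eq_dim)
  moreover have "independent (B - {vec 1})"
    using B(3) by (rule independent_mono) auto
  ultimately obtain F where F: "independent_family d F" "F ` {..<d} = B - {vec 1}"
    using independent_family_exists[of "B - {vec 1}" d] B(1) by auto
  have image: "case_nat (vec 1) F ` {..<Suc d} = B"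
    using F(2) B(1) by (auto simp: lessThan_Suc_eq_insert_0 image_image)
  \<comment> \<open>The \<open>Suc d\<close> indices have an image of \<open>Suc d\<close> elements,
    so none is repeated.\<close>
  have "inj_on (case_nat (vec 1) F) {..<Suc d}"
    using \<open>card B = Suc d\<close> image by (intro eq_card_imp_inj_on) auto
  then have indep: "independent_family (Suc d) (case_nat (vec 1) F)"
    using image B(3) by (metis independent_family_def)
  have S_iff: "f \<in> S \<longleftrightarrow> (\<exists>c \<theta>. f = c *\<^sub>R vec 1 + (\<Sum>i<d. \<theta> i *\<^sub>R F i))" for f
  proof -
    have "S = span (insert (vec 1) (F ` {..<d}))"
      using span_B F(2) B(1) by (simp add: insert_absorb)
    then have "f \<in> S \<longleftrightarrow> (\<exists>c. f - c *\<^sub>R vec 1 \<in> range (\<lambda>\<theta>. \<Sum>i<d. \<theta> i *\<^sub>R F i))"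
      by (simp add: span_breakdown_eq span_independent_family[OF F(1)])
    then show ?thesis
      by (simp add: image_iff diff_eq_eq add.commute)
  qed
  have "{p \<in> pos_dists. (\<chi> z. ln (p $ z)) \<in> S} = range (exp_member 0 F d)"
  proof (intro equalityI subsetI)
    fix p assume "p \<in> range (exp_member 0 F d)"
    then obtain \<theta> where p: "p = exp_member 0 F d \<theta>"
      by blast
    have "(\<chi> z. ln (p $ z)) = (- log_partition 0 F d \<theta>) *\<^sub>R vec 1 + (\<Sum>i<d. \<theta> i *\<^sub>R F i)"
      by (simp add: p ln_exp_member vec_eq_iff)
    then show "p \<in> {p \<in> pos_dists. (\<chi> z. ln (p $ z)) \<in> S}"
      using S_iff p exp_member_in_pos_dists by blast
  next
    fix p :: "real ^ 'z"
    assume p: "p \<in> {p \<in> pos_dists. (\<chi> z. ln (p $ z)) \<in> S}"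
    then obtain c \<theta> where "(\<chi> z. ln (p $ z)) = c *\<^sub>R vec 1 + (\<Sum>i<d. \<theta> i *\<^sub>R F i)"
      using S_iff by blast
    then have ln_p: "ln (p $ z) = c + (\<Sum>i<d. \<theta> i * F i $ z)" for z
      by (simp add: vec_eq_iff)
    have p_eq: "p $ z = exp c * exp (\<Sum>i<d. \<theta> i * F i $ z)" for z
      using p ln_p[of z] by (metis (lifting) exp_add exp_ln mem_Collect_eq pos_dists_def)
    \<comment> \<open>Total mass 1 determines the constant \<open>c\<close>.\<close>
    have "1 = (\<Sum>z\<in>UNIV. p $ z)"
      using p by (simp add: pos_dists_def)
    also have "\<dots> = exp c * exp (log_partition 0 F d \<theta>)"
      by (simp add: p_eq exp_log_partition sum_distrib_left)
    finally have "c = - log_partition 0 F d \<theta>"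
      by (metis add_eq_0_iff exp_add exp_eq_one_iff add.commute)
    then have "p = exp_member 0 F d \<theta>"
      by (simp add: vec_eq_iff p_eq exp_member_def flip: exp_add)
    then show "p \<in> range (exp_member 0 F d)"
      by blast
  qed
  then show ?thesis
    using indep unfolding e_family_def by blast
qed

text \<open>The elements of \<open>S\<close> with coordinate sum 1 form the affine space
  \<open>C + S0\<close>, where \<open>C\<close> is uniform and \<open>S0\<close> is the zero-sum
  part of \<open>S\<close>. Since \<open>S\<close> is the direct sum of \<open>S0\<close> and the
  constants, a basis of \<open>S0\<close> has \<open>d\<close> elements.\<close>

lemma m_family_subspace:
  fixes S :: "(real ^ 'z) set"
  assumes "subspace S" "vec 1 \<in> S" "dim S = Suc d"
  shows "m_family d {p \<in> pos_dists. p \<in> S}"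
proof -
  define S0 where "S0 = {f \<in> S. (\<Sum>z\<in>UNIV. f $ z) = 0}"
  have sub: "subspace S0"
    using assms(1) unfolding S0_def subspace_def
    by (auto simp: sum.distrib simp flip: sum_distrib_left)
  obtain B where B: "B \<subseteq> S0" "independent B" "S0 \<subseteq> span B"
    using maximal_independent_subset by blast
  have span_B: "span B = S0"
    using B sub by (simp add: span_minimal subset_antisym)
  have one: "vec 1 \<notin> span B"
    by (simp add: span_B S0_def)
  have indep: "independent (insert (vec 1) B)"
    using one B(2) by (simp add: independent_insert)
  have "S \<subseteq> span (insert (vec 1) B)"
  proof
    fix f assume "f \<in> S"
    \<comment> \<open>Subtracting the mean of \<open>f\<close> leaves a zero-sum element of
      \<open>S\<close>.\<close>
    then have "f - ((\<Sum>z\<in>UNIV. f $ z) / CARD('z)) *\<^sub>R vec 1 \<in> span B"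
      using assms(1,2) by (simp add: span_B S0_def sum_subtractf subspace_diff subspace_scale)
    then show "f \<in> span (insert (vec 1) B)"
      using span_breakdown_eq by blast
  qed
  moreover have "insert (vec 1) B \<subseteq> S"
    using B(1) assms(2) by (auto simp: S0_def)
  ultimately have "card (insert (vec 1) B) = Suc d"
    using indep assms(3) by (metis basis_card_eq_dim)
  moreover have "vec 1 \<notin> B"
    using one span_base by blast
  ultimately have "card B = d"
    using finiteI_independent[OF B(2)] by simp
  then obtain F where F: "independent_family d F" "F ` {..<d} = B"
    using independent_family_exists[OF B(2)] by blast
  have S0_eq: "S0 = range (\<lambda>\<xi>. \<Sum>i<d. \<xi> i *\<^sub>R F i)"
    using span_independent_family[OF F(1)] F(2) span_B by simp
  define C :: "real ^ 'z" where "C = (1 / CARD('z)) *\<^sub>R vec 1"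
  have C: "C \<in> S" "(\<Sum>z\<in>UNIV. C $ z) = 1" "\<And>z. C $ z > 0"
    using assms(1,2) by (simp_all add: C_def subspace_scale)
  have S0_iff: "f - C \<in> S0 \<longleftrightarrow> f \<in> S \<and> (\<Sum>z\<in>UNIV. f $ z) = 1" for f
    using C(1,2) subspace_diff[OF assms(1), of f C] subspace_add[OF assms(1), of "f - C" C]
    by (auto simp: S0_def sum_subtractf)
  have "f \<in> range (\<lambda>\<xi>. C + (\<Sum>i<d. \<xi> i *\<^sub>R F i)) \<longleftrightarrow> f - C \<in> S0" for f
    unfolding S0_eq by (auto simp: image_iff diff_eq_eq add.commute)
  then have M_eq: "{p \<in> pos_dists. p \<in> S}
      = range (\<lambda>\<xi>. C + (\<Sum>i<d. \<xi> i *\<^sub>R F i)) \<inter> {p. \<forall>z. p $ z > 0}"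
    using S0_iff by (auto simp: pos_dists_def)
  have "C \<in> {p \<in> pos_dists. p \<in> S}"
    using C by (simp add: pos_dists_def)
  moreover have "\<forall>i<d. (\<Sum>z\<in>UNIV. F i $ z) = 0"
    using F(2) B(1) by (auto simp: S0_def)
  ultimately show ?thesis
    using F(1) C(2) M_eq unfolding m_family_def by blast
qed

section \<open>Symmetric functions\<close>

text \<open>These are the functions that factor through \<open>g\<close>. Symmetric functions are
  the case where \<open>g\<close> sends an ordered pair to the unordered one.\<close>

lemma subspace_factoring: "subspace {f :: real ^ 'z. \<forall>z w. g z = g w \<longrightarrow> f $ z = f $ w}"
proof (rule subspaceI; unfold mem_Collect_eq; intro allI impI)
  fix x y :: "real ^ 'z" and c :: real and z w :: 'z
  assume "g z = g w" and x: "\<forall>z w. g z = g w \<longrightarrow> x $ z = x $ w"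
  then have "x $ z = x $ w"
    by blast
  then show "(c *\<^sub>R x) $ z = (c *\<^sub>R x) $ w"
    by simp
  assume y: "\<forall>z w. g z = g w \<longrightarrow> y $ z = y $ w"
  with \<open>g z = g w\<close> have "y $ z = y $ w"
    by blast
  with \<open>x $ z = x $ w\<close> show "(x + y) $ z = (x + y) $ w"
    by simp
qed simp

text \<open>The indicators of the nonempty fibres of \<open>g\<close> are nonzero and pairwise
  orthogonal, and they span the functions constant on fibres.\<close>

lemma dim_factoring:
  fixes g :: "'z::finite \<Rightarrow> 'k"
  shows "dim {f :: real ^ 'z. \<forall>z w. g z = g w \<longrightarrow> f $ z = f $ w} = card (range g)"
    (is "dim ?S = _")
proof -
  define e :: "'k \<Rightarrow> real ^ 'z" where "e k = (\<chi> z. of_bool (g z = k))" for k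
  have e_nz: "e k \<noteq> 0" if "k \<in> range g" for k
    using that by (auto simp: e_def vec_eq_iff)
  have orth: "e k \<bullet> e l = 0" if "k \<noteq> l" for k l
    using that by (auto simp: e_def inner_vec_def intro!: sum.neutral)
  have inj: "inj_on e (range g)"
    using e_nz orth by (metis inj_onI inner_eq_zero_iff)
  have "pairwise orthogonal (e ` range g)"
    using orth unfolding pairwise_def orthogonal_def by (metis imageE)
  then have "independent (e ` range g)"
    using e_nz by (intro pairwise_orthogonal_independent) auto
  moreover have "e ` range g \<subseteq> ?S"
    by (auto simp: e_def)
  moreover have "?S \<subseteq> span (e ` range g)"
  proof
    fix f assume f: "f \<in> ?S"
    \<comment> \<open>The coefficient on a fibre is the value of \<open>f\<close> there, read off at
      the representative chosen by \<open>inv g\<close>.\<close>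
    define h where "h = (\<Sum>k\<in>range g. f $ (inv g k) *\<^sub>R e k)"
    have "h $ z = f $ z" for z
    proof -
      have "h $ z = (\<Sum>k\<in>range g. if g z = k then f $ (inv g k) else 0)"
        by (simp add: h_def e_def of_bool_def if_distrib cong: if_cong)
      also have "\<dots> = f $ (inv g (g z))"
        by simp
      also have "\<dots> = f $ z"
        using f f_inv_into_f[of "g z" g UNIV] by blast
      finally show ?thesis .
    qed
    then have "h = f"
      by (simp add: vec_eq_iff)
    moreover have "h \<in> span (e ` range g)"
      unfolding h_def by (intro span_sum span_scale span_base imageI)
    ultimately show "f \<in> span (e ` range g)"
      by simp
  qed
  ultimately have "dim ?S = card (e ` range g)"
    by (intro basis_card_eq_dim[symmetric])
  then show ?thesis
    using inj by (simp add: card_image)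
qed

text \<open>The pairs with x = y give the singletons and the others the two-element sets, so with n
  elements the count is n + (n choose 2) = (n + 1 choose 2).\<close>

lemma card_unordered_pairs:
  "card (range (\<lambda>(x, y). {x, y :: 'x::finite})) = CARD('x) * (CARD('x) + 1) div 2"
proof -
  have "range (\<lambda>(x, y). {x, y :: 'x}) = {A. card A = 1} \<union> {A. card A = 2}"
    by (auto simp: card_1_singleton_iff card_2_iff image_iff card_insert_if)
  also have "card \<dots> = card {A :: 'x set. card A = 1} + card {A :: 'x set. card A = 2}"
    by (intro card_Un_disjoint) auto
  also have "\<dots> = CARD('x) + (CARD('x) choose 2)"
    using n_subsets[of "UNIV :: 'x set" 1] n_subsets[of "UNIV :: 'x set" 2] by simp
  also have "\<dots> = (CARD('x) + 1) choose 2"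
    by (simp add: numeral_2_eq_2)
  finally show ?thesis
    by (simp add: choose_two mult.commute)
qed

lemma rev_edge_measures_families:
  fixes d :: nat
  defines "d \<equiv> CARD('x::finite) * (CARD('x) + 1) div 2 - 1"
  shows "e_family d (rev_edge_measures :: (real ^ ('x \<times> 'x)) set)"
    and "m_family d (rev_edge_measures :: (real ^ ('x \<times> 'x)) set)"
proof -
  define g :: "'x \<times> 'x \<Rightarrow> 'x set" where "g = (\<lambda>(x, y). {x, y})"
  define S where "S = {f :: real ^ ('x \<times> 'x). \<forall>z w. g z = g w \<longrightarrow> f $ z = f $ w}"
  have S_iff: "f \<in> S \<longleftrightarrow> (\<forall>x y. f $ (x, y) = f $ (y, x))" for f
    by (auto simp: S_def g_def doubleton_eq_iff)
  have "dim S = CARD('x) * (CARD('x) + 1) div 2"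
    unfolding S_def dim_factoring unfolding g_def by (rule card_unordered_pairs)
  \<comment> \<open>Positivity of the dimension makes the truncated subtraction in \<open>d\<close>
    exact.\<close>
  moreover have "range g \<noteq> {}"
    by simp
  then have "dim S > 0"
    unfolding S_def dim_factoring by (simp add: card_gt_0_iff)
  ultimately have "dim S = Suc d"
    by (simp add: d_def)
  moreover have "subspace S"
    unfolding S_def by (rule subspace_factoring)
  moreover have "vec 1 \<in> S"
    by (simp add: S_iff)
  ultimately have S: "subspace S" "vec 1 \<in> S" "dim S = Suc d"
    by blast+
  \<comment> \<open>As \<open>ln\<close> is injective on positive reals, log p is symmetric exactly
    when p is.\<close>
  have ln_iff: "(\<chi> z. ln (p $ z)) \<in> S \<longleftrightarrow> p \<in> S" if "p \<in> pos_dists" for p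
    using that by (simp add: S_iff pos_dists_def)
  have "rev_edge_measures = {p \<in> pos_dists. p \<in> S}"
    by (simp add: rev_edge_measures_def S_iff)
  moreover have "\<dots> = {p \<in> pos_dists. (\<chi> z. ln (p $ z)) \<in> S}"
    using ln_iff by blast
  ultimately show "e_family d (rev_edge_measures :: (real ^ ('x \<times> 'x)) set)"
    and "m_family d (rev_edge_measures :: (real ^ ('x \<times> 'x)) set)"
    using e_family_log_subspace[OF S] m_family_subspace[OF S] by simp_all
qed

section \<open>Edge measures that are not reversible\<close>

text \<open>With two states, the diagonal term cancels from the balance equation at
  \<open>a\<close>, which leaves Q(a,b) = Q(b,a).\<close>

lemma edge_measures_eq_rev_if_card_2:
  assumes "CARD('x::finite) = 2"
  shows "(edge_measures :: (real ^ ('x \<times> 'x)) set) = rev_edge_measures"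
proof -
  obtain a b :: 'x where ab: "UNIV = {a, b}" "a \<noteq> b"
    using assms by (auto simp: card_2_iff)
  have all: "(\<forall>x. P x) \<longleftrightarrow> P a \<and> P b" for P :: "'x \<Rightarrow> bool"
    using ab(1) by (metis UNIV_I insertE singletonD)
  show ?thesis
    using ab(2) unfolding edge_measures_def rev_edge_measures_def ab(1) all by auto
qed

text \<open>Up to normalization, the logarithm of a member is affine in the parameter, so the
  parameters combine with weights \<open>t\<close> and \<open>1 - t\<close>. Here \<open>t\<close>
  is any real number; values outside [0,1] extrapolate.\<close>

lemma e_family_geometric:
  assumes "e_family d E" "p \<in> E" "q \<in> E"
  obtains r c where "r \<in> E" "c > 0" "\<And>z. r $ z = c * (p $ z powr t * q $ z powr (1 - t))"
proof -
  obtain C F where E: "E = range (exp_member C F d)"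
    using assms(1) by (auto simp: e_family_def)
  obtain \<theta> \<eta> where p: "p = exp_member C F d \<theta>" and q: "q = exp_member C F d \<eta>"
    using assms(2,3) E by auto
  define \<zeta> where "\<zeta> i = t * \<theta> i + (1 - t) * \<eta> i" for i
  define c where "c = exp (t * log_partition C F d \<theta> + (1 - t) * log_partition C F d \<eta>
    - log_partition C F d \<zeta>)"
  have "(\<Sum>i<d. \<zeta> i * F i $ z)
      = t * (\<Sum>i<d. \<theta> i * F i $ z) + (1 - t) * (\<Sum>i<d. \<eta> i * F i $ z)" for z
    by (simp add: \<zeta>_def sum_distrib_left algebra_simps sum.distrib sum_subtractf)
  then have "exp_member C F d \<zeta> $ z = c * (p $ z powr t * q $ z powr (1 - t))" for z
    by (simp add: p q exp_member_def c_def powr_def algebra_simps flip: exp_add)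
  then show ?thesis
    using that[of "exp_member C F d \<zeta>" c] E by (simp add: c_def)
qed

text \<open>The edge a -> b, shared by both cycles, has its own increment \<open>s\<close>, so that
  for distinct states entrywise squaring stays within this family of weights. The case
  \<open>s = t = 0\<close> is uniform.\<close>

definition two_cycle_weights :: "'x \<Rightarrow> 'x \<Rightarrow> 'x \<Rightarrow> real \<Rightarrow> real \<Rightarrow> 'x \<times> 'x \<Rightarrow> real" where
  "two_cycle_weights a b c s t = (\<lambda>(x, y). 1 + (if x = a \<and> y = b then s else 0)
    + (if x = b \<and> y = a then t else 0) + (if x = b \<and> y = c then t else 0)
    + (if x = c \<and> y = a then t else 0))"

lemma two_cycle_weights_pos: "s \<ge> 0 \<Longrightarrow> t \<ge> 0 \<Longrightarrow> two_cycle_weights a b c s t z > 0"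
  by (cases z) (simp add: two_cycle_weights_def add_pos_nonneg)

lemma sum_delta_conj:
  fixes s :: real and a b x :: "'x::finite"
  shows "(\<Sum>y\<in>UNIV. if x = a \<and> y = b then s else 0) = (if x = a then s else 0)"
    and "(\<Sum>y\<in>UNIV. if y = a \<and> x = b then s else 0) = (if x = b then s else 0)"
proof -
  show left: "(\<Sum>y\<in>UNIV. if x = a \<and> y = b then s else 0) = (if x = a then s else 0)"
    for a b :: 'x
  proof (cases "x = a")
    case True
    then show ?thesis by simp
  next
    case False
    then show ?thesis by simp
  qed
  show "(\<Sum>y\<in>UNIV. if y = a \<and> x = b then s else 0) = (if x = b then s else 0)"
    using left[of b a] by (simp only: conj_commute)
qed

lemma sum_two_cycle_weights:
  fixes a b c x :: "'x::finite" and s t :: real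
  shows "(\<Sum>y\<in>UNIV. two_cycle_weights a b c s t (x, y)) = CARD('x) + (if x = a then s else 0)
      + (if x = b then t else 0) + (if x = b then t else 0) + (if x = c then t else 0)"
    and "(\<Sum>y\<in>UNIV. two_cycle_weights a b c s t (y, x)) = CARD('x) + (if x = b then s else 0)
      + (if x = a then t else 0) + (if x = c then t else 0) + (if x = a then t else 0)"
  unfolding two_cycle_weights_def prod.case sum.distrib sum_delta_conj by simp_all

text \<open>Outflow minus inflow is \<open>s - 2 * t\<close> at \<open>a\<close>, its negative at
  \<open>b\<close>, and zero elsewhere. Scaling by \<open>k\<close> does not affect balance and only
  fixes the total mass. One direction supplies members, the other refutes membership.\<close>

lemma edge_measures_two_cycle_weights:
  fixes a b c :: "'x::finite"
  assumes "distinct [a, b, c]" "k > 0" "s \<ge> 0" "t \<ge> 0"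
  shows "(\<chi> z. two_cycle_weights a b c s t z / k) \<in> edge_measures
    \<longleftrightarrow> s = 2 * t \<and> k = (\<Sum>z\<in>UNIV. two_cycle_weights a b c s t z)"
proof -
  define w where "w = two_cycle_weights a b c s t"
  have w_pos: "w z > 0" for z
    using assms(3,4) by (simp add: w_def two_cycle_weights_pos)
  have "(\<chi> z. w z / k) \<in> pos_dists \<longleftrightarrow> (\<Sum>z\<in>UNIV. w z) / k = 1"
    using assms(2) w_pos by (simp add: pos_dists_def flip: sum_divide_distrib)
  then have "(\<chi> z. w z / k) \<in> pos_dists \<longleftrightarrow> k = (\<Sum>z\<in>UNIV. w z)"
    using assms(2) by (metis divide_eq_1_iff less_irrefl)
  moreover have "(\<chi> z. w z / k) \<in> edge_measures \<longleftrightarrow> (\<chi> z. w z / k) \<in> pos_dists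
      \<and> (\<forall>x. (\<Sum>y\<in>UNIV. w (x, y)) = (\<Sum>y\<in>UNIV. w (y, x)))"
    using assms(2) by (simp add: edge_measures_def flip: sum_divide_distrib)
  moreover have "(\<forall>x. (\<Sum>y\<in>UNIV. w (x, y)) = (\<Sum>y\<in>UNIV. w (y, x))) \<longleftrightarrow> s = 2 * t"
  proof
    assume "\<forall>x. (\<Sum>y\<in>UNIV. w (x, y)) = (\<Sum>y\<in>UNIV. w (y, x))"
    then have "(\<Sum>y\<in>UNIV. w (a, y)) = (\<Sum>y\<in>UNIV. w (y, a))"
      by blast
    then show "s = 2 * t"
      using assms(1) by (simp add: w_def sum_two_cycle_weights)
  next
    assume "s = 2 * t"
    then show "\<forall>x. (\<Sum>y\<in>UNIV. w (x, y)) = (\<Sum>y\<in>UNIV. w (y, x))"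
      using assms(1) by (simp add: w_def sum_two_cycle_weights)
  qed
  ultimately show ?thesis
    unfolding w_def by blast
qed

lemma not_e_family_edge_measures:
  assumes "CARD('x::finite) \<ge> 3"
  shows "\<not> e_family d (edge_measures :: (real ^ ('x \<times> 'x)) set)"
proof
  assume e_fam: "e_family d (edge_measures :: (real ^ ('x \<times> 'x)) set)"
  obtain T :: "'x set" where "card T = 3"
    using assms obtain_subset_with_card_n by blast
  then obtain a b c :: 'x where abc: "distinct [a, b, c]"
    by (auto simp: card_3_iff)
  define W where "W = two_cycle_weights a b c"
  define K where "K s t = (\<Sum>z\<in>UNIV. W s t z)" for s t
  have W_pos: "W s t z > 0" if "s \<ge> 0" "t \<ge> 0" for s t z
    using that by (simp add: W_def two_cycle_weights_pos)
  then have K_pos: "K s t > 0" if "s \<ge> 0" "t \<ge> 0" for s t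
    using that unfolding K_def by (intro sum_pos) auto
  have mem: "(\<chi> z. W s t z / K s t) \<in> edge_measures" if "s = 2 * t" "t \<ge> 0" for s t
    using edge_measures_two_cycle_weights[OF abc, of "K s t" s t] that K_pos[of s t]
    by (simp add: W_def K_def)
  obtain r k where r: "r \<in> edge_measures" "k > 0"
    and r_eq: "\<And>z. r $ z = k * ((W 2 1 z / K 2 1) powr 2 * (W 0 0 z / K 0 0) powr (1 - 2))"
    \<comment> \<open>Exponents 2 and -1, the latter on the uniform distribution, yield a multiple
      of the square.\<close>
    using e_family_geometric[OF e_fam mem[of 2 1] mem[of 0 0], of 2] by auto
  \<comment> \<open>All constant factors of \<open>r\<close> are collected into one divisor.\<close>
  define k' where "k' = (K 2 1)\<^sup>2 / (k * K 0 0)"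
  have k': "k' > 0"
    using r(2) K_pos[of 2 1] K_pos[of 0 0] by (simp add: k'_def)
  \<comment> \<open>The entries 3, 2 and 1 square to 1 + 8, 1 + 3 and 1; distinctness of the states
    ensures that no two increments fall on the same edge.\<close>
  have sq: "(W 2 1 z)\<^sup>2 = W 8 3 z" for z
    using abc unfolding W_def two_cycle_weights_def by (cases z) (simp split: if_split, blast)
  have W_0: "W 0 0 z = 1" for z
    by (simp add: W_def two_cycle_weights_def split: prod.split)
  have "r $ z = W 8 3 z / k'" for z
  proof -
    have "W 2 1 z / K 2 1 > 0" "1 / K 0 0 > 0"
      using W_pos K_pos by simp_all
    then show ?thesis
      unfolding r_eq W_0 k'_def by (simp add: powr_minus power_divide sq)
  qed
  then have "(\<chi> z. W 8 3 z / k') = r"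
    by (simp add: vec_eq_iff)
  then have "(\<chi> z. W 8 3 z / k') \<in> edge_measures"
    using r(1) by (simp only:)
  \<comment> \<open>Balance would require 8 = 2 * 3.\<close>
  then show False
    using edge_measures_two_cycle_weights[OF abc k', of 8 3] by (simp add: W_def)
qed

theorem theorem7p1:
  assumes "CARD('x::finite) \<ge> 2"
  shows "e_family (CARD('x) * (CARD('x) + 1) div 2 - 1)
           (rev_edge_measures :: (real ^ ('x \<times> 'x)) set) \<and>
         m_family (CARD('x) * (CARD('x) + 1) div 2 - 1)
           (rev_edge_measures :: (real ^ ('x \<times> 'x)) set) \<and>
         ((\<exists>d. e_family d (edge_measures :: (real ^ ('x \<times> 'x)) set)) \<longleftrightarrow> CARD('x) = 2)"
proof (intro conjI iffI)
  assume "\<exists>d. e_family d (edge_measures :: (real ^ ('x \<times> 'x)) set)"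
  then have "\<not> CARD('x) \<ge> 3"
    using not_e_family_edge_measures by blast
  then show "CARD('x) = 2"
    using assms by simp
next
  assume "CARD('x) = 2"
  then show "\<exists>d. e_family d (edge_measures :: (real ^ ('x \<times> 'x)) set)"
    using edge_measures_eq_rev_if_card_2 rev_edge_measures_families(1) by metis
qed (rule rev_edge_measures_families)+

end
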